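(* Let $x\ge 1$ and $\rho\ge 2$ be integers that are relatively prime and satisfy $x^{\rho-1}\equiv 1 \pmod{\rho}$. For each integer $n\ge 0$ let $J_n$ be the number of integer multiples of $\rho$ which are greater than $x^n$ and less than $x^{n+1}$. Then for every integer $n\ge 0$, $$J_{n+\rho-1}=(x-1)\sum_{i=1}^{\rho-2}J_{n-i+\rho-1}+xJ_n .$$
   Context: The sequence $(J_n)_{n\ge 0}$ is called the multiple-counting sequence of $\rho$ between exponents of $x$; in terms of floor functions, $J_n=\left\lfloor \frac{x^{n+1}}{\rho}\right\rfloor-\left\lfloor \frac{x^{n}}{\rho}\right\rfloor$. An empty sum (the case $\rho=2$) equals $0$. The number $\rho$ is not assumed to be prime. *)

theory Defs
  imports "HOL-Number_Theory.Cong"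
begin

definition multiple_count :: "int \<Rightarrow> nat \<Rightarrow> nat \<Rightarrow> nat" where
  "multiple_count x \<rho> n = card {m :: int. int \<rho> dvd m \<and> x ^ n < m \<and> m < x ^ (n + 1)}"

end

theory Submission
  imports Defs
begin

text \<open>Put \<open>q n = \<lfloor>x ^ n / \<rho>\<rfloor>\<close> and \<open>d = \<rho> - 1\<close>. Since \<open>J n = q (n + 1) - q n\<close>, the sum
  telescopes to \<open>q (n + d) - q (n + 1)\<close> and the recurrence becomes
  \<open>q (n + 1 + d) - q (n + 1) = x * (q (n + d) - q n)\<close>. This holds because the residues of
  \<open>x ^ n\<close> modulo \<open>\<rho>\<close> have period \<open>d\<close>, so that
  \<open>\<rho> * (q (n + d) - q n) = x ^ (n + d) - x ^ n\<close>.\<close>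

lemma le_div_iff_mult_le_int:
  fixes b k r :: int
  assumes "r > 0"
  shows "k \<le> b div r \<longleftrightarrow> r * k \<le> b"
proof
  assume "k \<le> b div r"
  then have "r * k \<le> r * (b div r)"
    using assms by simp
  also have "\<dots> \<le> b"
    using mult_div_mod_eq[of r b] pos_mod_sign[OF assms, of b] by linarith
  finally show "r * k \<le> b" .
next
  assume "r * k \<le> b"
  then show "k \<le> b div r"
    using zdiv_mono1[OF _ assms, of "r * k" b] assms by simp
qed

text \<open>A multiple \<open>r * k\<close> lies strictly between the bounds exactly when
  \<open>a div r < k \<le> b div r\<close>. The upper end is closed because \<open>r * k = b\<close>
  is ruled out by \<open>\<not> r dvd b\<close>; the lower end needs no such condition on
  \<open>a\<close>.\<close>

lemma card_multiples_between:
  fixes a b r :: int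
  assumes "r > 0" "a \<le> b" "\<not> r dvd b"
  shows "int (card {m. r dvd m \<and> a < m \<and> m < b}) = b div r - a div r"
proof -
  have lower: "a < r * k \<longleftrightarrow> a div r < k" for k
    using le_div_iff_mult_le_int[OF assms(1), of k a] by linarith
  have upper: "r * k < b \<longleftrightarrow> k \<le> b div r" for k
    using le_div_iff_mult_le_int[OF assms(1), of k b] assms(3)
    by (auto simp: order_less_le)
  have "{m. r dvd m \<and> a < m \<and> m < b} = (*) r ` {a div r<..b div r}"
    using lower upper by (auto elim!: dvdE)
  moreover have "inj_on ((*) r) {a div r<..b div r}"
    using assms(1) by (auto intro: inj_onI)
  moreover have "a div r \<le> b div r"
    using assms(1,2) by (rule zdiv_mono1[rotated])
  ultimately show ?thesis
    by (simp add: card_image)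
qed

lemma multiple_count_eq_div_diff:
  assumes "x \<ge> 1" "\<rho> \<ge> 2" "coprime x (int \<rho>)"
  shows "int (multiple_count x \<rho> n) = x ^ (n + 1) div int \<rho> - x ^ n div int \<rho>"
proof -
  have "coprime (x ^ (n + 1)) (int \<rho>)"
    using assms(3) by simp
  \<comment> \<open>Otherwise \<open>\<rho>\<close> would be a common divisor of a coprime pair,
    hence a unit, against \<open>\<rho> \<ge> 2\<close>.\<close>
  then have "\<not> int \<rho> dvd x ^ (n + 1)"
    using assms(2) coprime_common_divisor[of "x ^ (n + 1)" "int \<rho>" "int \<rho>"]
    by fastforce
  moreover have "x ^ n \<le> x ^ (n + 1)"
    using assms(1) by (intro power_increasing) auto
  ultimately show ?thesis
    unfolding multiple_count_def using assms(2) by (intro card_multiples_between) auto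
qed

text \<open>Congruent numbers leave the same remainder, which cancels on subtracting the two
  division identities.\<close>

lemma mult_div_diff_of_cong:
  fixes a b r :: int
  assumes "[a = b] (mod r)"
  shows "r * (a div r - b div r) = a - b"
  using assms mult_div_mod_eq[of r a] mult_div_mod_eq[of r b]
  unfolding cong_def right_diff_distrib by linarith

lemma sum_rev_telescope:
  fixes q :: "nat \<Rightarrow> int"
  assumes "d \<ge> 1"
  shows "(\<Sum>i = 1..d - 1. q (n + d - i + 1) - q (n + d - i)) = q (n + d) - q (n + 1)"
proof -
  have "(\<Sum>i = 1..d - 1. q (n + d - i + 1) - q (n + d - i))
      = (\<Sum>k = n + 1..<n + d. q (Suc k) - q k)"
    \<comment> \<open>Reversal \<open>k = n + d - i\<close>; as \<open>i < d\<close>, the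
      subtraction on naturals never truncates. For \<open>d = 1\<close> both sums are empty.\<close>
    by (rule sum.reindex_bij_witness[of _ "\<lambda>k. n + d - k" "\<lambda>i. n + d - i"]) auto
  also have "\<dots> = q (n + d) - q (n + 1)"
    using assms by (intro sum_Suc_diff') simp
  finally show ?thesis .
qed

theorem theorem2:
  fixes x :: int and \<rho> n :: nat
  assumes "x \<ge> 1" and "\<rho> \<ge> 2"
    and "coprime x (int \<rho>)"
    and "[x ^ (\<rho> - 1) = 1] (mod (int \<rho>))"
  shows "int (multiple_count x \<rho> (n + \<rho> - 1)) =
    (x - 1) * (\<Sum>i = 1..\<rho> - 2. int (multiple_count x \<rho> (n + \<rho> - 1 - i)))
      + x * int (multiple_count x \<rho> n)"
proof -
  define d where "d = \<rho> - 1"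
  have d: "d \<ge> 1" "n + \<rho> - 1 = n + d" "\<rho> - 2 = d - 1"
    using assms(2) by (auto simp: d_def)
  define q where "q k = x ^ k div int \<rho>" for k
  have count: "int (multiple_count x \<rho> k) = q (k + 1) - q k" for k
    unfolding q_def using assms(1-3) by (rule multiple_count_eq_div_diff)
  have period: "int \<rho> * (q (k + d) - q k) = x ^ (k + d) - x ^ k" for k
  proof -
    have "[x ^ k * x ^ d = x ^ k * 1] (mod int \<rho>)"
      using assms(4) unfolding d_def by (rule cong_scalar_left)
    then show ?thesis
      unfolding q_def by (intro mult_div_diff_of_cong) (simp add: power_add)
  qed
  \<comment> \<open>Periodicity at \<open>n + 1\<close> yields a difference of powers that is
    \<open>x\<close> times the one at \<open>n\<close>.\<close>
  have "int \<rho> * (q (n + 1 + d) - q (n + 1)) = x * (x ^ (n + d) - x ^ n)"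
    unfolding period by (simp add: algebra_simps)
  also have "\<dots> = int \<rho> * (x * (q (n + d) - q n))"
    unfolding period[symmetric] by (simp add: mult.left_commute)
  finally have "q (n + 1 + d) - q (n + 1) = x * (q (n + d) - q n)"
    using assms(2) by simp
  \<comment> \<open>The terms in \<open>x * q (n + 1)\<close> from the telescoped sum and from
    \<open>x * J n\<close> cancel, which leaves the identity just obtained.\<close>
  then show ?thesis
    unfolding d count sum_rev_telescope[OF d(1)] by (simp add: algebra_simps)
qed

end
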